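(* Let $L_{\mathcal{P}}=\{u\in\{0,1\}^+\mid u=u^R\}$ be the set of nonempty binary palindromes and $L_{\mathrm{wrep}}=(1\cup\lambda)(01)^*(0\cup\lambda)$. Then $\mathcal{G}_{L_{\mathcal{P}}\cap L_{\mathrm{wrep}}}$ is exactly the class of bipartite graphs.
   Context: All graphs are finite, simple, undirected, with nonempty vertex sets, and graph classes are considered up to isomorphism; a graph is bipartite if its vertex set is the union of two disjoint independent sets (so the one-vertex graph is bipartite). $u^R$ denotes the reversal of $u$, $\lambda$ the empty word. For an alphabet $V$ and distinct $u,v\in V$, $h_{u,v}:V^*\to\{0,1\}^*$ is the monoid morphism with $u\mapsto 0$, $v\mapsto 1$ and $x\mapsto\lambda$ for all other letters $x$. For a language $L\subseteq\{0,1\}^*$ closed under exchanging 0 and 1 (0-1-symmetric) and a nonempty word $w$ whose set of occurring letters is $V$, $G(L,w)$ is the graph with vertex set $V$ in which distinct $u,v$ are adjacent iff $h_{u,v}(w)\in L$. $\mathcal{G}_L$ is the class of all graphs isomorphic to some $G(L,w)$. *)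

theory Defs
  imports
    "Graph_Theory.Pair_Digraph"
    "Graph_Theory.Digraph_Isomorphism"
    "HOL-Library.Z2"
begin

text \<open>
  A simple undirected graph is a \<^locale>\<open>pair_graph\<close>: finite, loop-free, and with a symmetric
  set of arcs, so that an edge is represented by its two opposite arcs. The library locale
  admits the empty graph, which is excluded here.
\<close>

definition simple_graph :: "'a pair_pre_digraph \<Rightarrow> bool" where
  "simple_graph G \<longleftrightarrow> pair_graph G \<and> pverts G \<noteq> {}"

definition independent :: "'a pair_pre_digraph \<Rightarrow> 'a set \<Rightarrow> bool" where
  "independent G A \<longleftrightarrow> A \<subseteq> pverts G \<and> (\<forall>u\<in>A. \<forall>v\<in>A. (u, v) \<notin> parcs G)"

definition bipartite :: "'a pair_pre_digraph \<Rightarrow> bool" where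
  "bipartite G \<longleftrightarrow>
     (\<exists>A B. pverts G = A \<union> B \<and> A \<inter> B = {} \<and> independent G A \<and> independent G B)"

text \<open>Binary words are lists over the two-element type \<^typ>\<open>bit\<close>.\<close>

definition exchange :: "bit \<Rightarrow> bit" where
  "exchange x = (if x = 0 then 1 else 0)"

definition zero_one_symmetric :: "bit list set \<Rightarrow> bool" where
  "zero_one_symmetric L \<longleftrightarrow> (\<forall>u\<in>L. map exchange u \<in> L)"

definition proj_word :: "'a \<Rightarrow> 'a \<Rightarrow> 'a list \<Rightarrow> bit list" where
  "proj_word u v w = concat (map (\<lambda>x. if x = u then [0] else if x = v then [1] else []) w)"

text \<open>
  The arc relation below is symmetric, and hence describes an undirected graph, only when \<open>L\<close> is
  0-1-symmetric; see \<open>simple_graph_word_graph\<close>.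
\<close>

definition word_graph :: "bit list set \<Rightarrow> 'a list \<Rightarrow> 'a pair_pre_digraph" where
  "word_graph L w =
     \<lparr> pverts = set w,
       parcs = {(u, v). u \<in> set w \<and> v \<in> set w \<and> u \<noteq> v \<and> proj_word u v w \<in> L} \<rparr>"

text \<open>
  Up to isomorphism every finite alphabet is a set of natural numbers, so words over \<^typ>\<open>nat\<close>
  represent words over arbitrary alphabets; the vertex type of the represented graphs is arbitrary.
\<close>

definition graph_class :: "bit list set \<Rightarrow> 'a pair_pre_digraph set" where
  "graph_class L =
     {G. simple_graph G \<and>
         (\<exists>w :: nat list. w \<noteq> [] \<and> digraph_iso (with_proj G) (with_proj (word_graph L w)))}"

definition lang_conc :: "'a list set \<Rightarrow> 'a list set \<Rightarrow> 'a list set" where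
  "lang_conc A B = {u @ v | u v. u \<in> A \<and> v \<in> B}"

definition lang_star :: "'a list set \<Rightarrow> 'a list set" where
  "lang_star A = {concat us | us. us \<in> lists A}"

definition L_pal :: "bit list set" where
  "L_pal = {u. u \<noteq> [] \<and> u = rev u}"

definition L_wrep :: "bit list set" where
  "L_wrep = lang_conc ({[1]} \<union> {[]}) (lang_conc (lang_star {[0, 1]}) ({[0]} \<union> {[]}))"

lemma map_exchange_proj_word:
  "u \<noteq> v \<Longrightarrow> map exchange (proj_word u v w) = proj_word v u w"
  by (induction w) (auto simp: proj_word_def exchange_def)

lemma simple_graph_word_graph:
  assumes "zero_one_symmetric L" and "w \<noteq> []"
  shows "simple_graph (word_graph L w)"
proof -
  have "proj_word v u w \<in> L" if "u \<noteq> v" "proj_word u v w \<in> L" for u v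
    using that assms(1) map_exchange_proj_word unfolding zero_one_symmetric_def by metis
  moreover have "finite (parcs (word_graph L w))"
    by (rule finite_subset[of _ "set w \<times> set w"]) (auto simp: word_graph_def)
  ultimately have "pair_graph (word_graph L w)"
    by unfold_locales (auto simp: word_graph_def symmetric_def intro!: symI)
  then show ?thesis
    using assms(2) by (simp add: simple_graph_def word_graph_def)
qed

lemma zero_one_symmetric_L_pal: "zero_one_symmetric L_pal"
  by (auto simp: zero_one_symmetric_def L_pal_def rev_map)

lemma lists_singleton_conv: "us \<in> lists {a} \<longleftrightarrow> (\<exists>n. us = replicate n a)"
proof
  assume "us \<in> lists {a}"
  then have "us = replicate (length us) a"
    by (induction us) auto
  then show "\<exists>n. us = replicate n a" ..
qed auto

lemma L_wrep_conv:
  "u \<in> L_wrep \<longleftrightarrow>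
     (\<exists>n. \<exists>x\<in>{[1], []}. \<exists>z\<in>{[0], []}. u = x @ concat (replicate n [0, 1]) @ z)"
  unfolding L_wrep_def lang_conc_def lang_star_def lists_singleton_conv by blast

lemma zero_one_symmetric_L_wrep: "zero_one_symmetric L_wrep"
proof -
  have shift: "concat (replicate n [1, 0]) @ [1] = 1 # concat (replicate n [0, 1 :: bit])" for n
    by (induction n) auto
  have shift': "0 # concat (replicate n [1, 0]) = concat (replicate n [0, 1 :: bit]) @ [0]" for n
    by (induction n) auto
  have ex: "map exchange (concat (replicate n [0, 1])) = concat (replicate n [1, 0])" for n
    by (induction n) (auto simp: exchange_def)
  have "map exchange u \<in> L_wrep" if "u \<in> L_wrep" for u
  proof -
    from that obtain n x z where u: "u = x @ concat (replicate n [0, 1]) @ z"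
      and x: "x = [1] \<or> x = []" and z: "z = [0] \<or> z = []"
      unfolding L_wrep_conv by blast
    have mu: "map exchange u = map exchange x @ concat (replicate n [1, 0]) @ map exchange z"
      by (simp add: u ex)
    from x z consider "x = [1]" "z = [0]" | "x = [1]" "z = []" | "x = []" "z = [0]"
      | "x = []" "z = []" by blast
    then show ?thesis
    proof cases
      case 1
      then have "map exchange u = [] @ concat (replicate (Suc n) [0, 1]) @ []"
        by (simp add: mu exchange_def shift)
      then show ?thesis unfolding L_wrep_conv by blast
    next
      case 2
      then have "map exchange u = [] @ concat (replicate n [0, 1]) @ [0]"
        by (simp add: mu exchange_def shift')
      then show ?thesis unfolding L_wrep_conv by blast
    next
      case 3
      then have "map exchange u = [1] @ concat (replicate n [0, 1]) @ []"
        by (simp add: mu exchange_def shift)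
      then show ?thesis unfolding L_wrep_conv by blast
    next
      case 4
      show ?thesis
      proof (cases n)
        case 0
        then have "map exchange u = [] @ concat (replicate 0 [0, 1]) @ []"
          using 4 by (simp add: mu)
        then show ?thesis unfolding L_wrep_conv by blast
      next
        case (Suc m)
        then have "map exchange u = [1] @ concat (replicate m [0, 1]) @ [0]"
          using 4 by (simp add: mu shift')
        then show ?thesis unfolding L_wrep_conv by blast
      qed
    qed
  qed
  then show ?thesis by (simp add: zero_one_symmetric_def)
qed

lemma zero_one_symmetric_L_pal_wrep: "zero_one_symmetric (L_pal \<inter> L_wrep)"
  using zero_one_symmetric_L_pal zero_one_symmetric_L_wrep
  by (auto simp: zero_one_symmetric_def)

end

theory Submission
  imports Defs
begin

text \<open>
  A word of \<open>L_pal \<inter> L_wrep\<close> has odd length, so adjacent letters occur with different parities, and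
  these parities give a bipartition. Conversely, let \<open>P\<close> and \<open>Q\<close> list the two parts of a bipartite
  graph. For each \<open>c\<close> in \<open>Q\<close> take the block \<open>P\<^sub>1 c P\<^sub>2 Q'\<close>, where \<open>P\<^sub>1\<close> and \<open>P\<^sub>2\<close> list the neighbours
  and the non-neighbours of \<open>c\<close> in \<open>P\<close> and \<open>Q'\<close> is \<open>Q\<close> without \<open>c\<close>. On a letter \<open>a\<close> of \<open>P\<close> and a
  letter \<open>b\<close> of \<open>Q\<close> this block projects to \<open>ba\<close> if \<open>c = b\<close> is not adjacent to \<open>a\<close>, and to \<open>ab\<close>
  otherwise. Hence the concatenation of all blocks, followed by \<open>P\<close>, projects to an alternating word
  exactly when \<open>a\<close> and \<open>b\<close> are adjacent. Letters of the same part occur equally often, so their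
  projection has even length.
\<close>

section \<open>Isomorphism of pair digraphs\<close>

text \<open>\<open>digraph_iso\<close> carries separate maps for vertices, arcs and arc ends;
  between pair digraphs the vertex map determines the others, so a single injection
  suffices.\<close>

lemma digraph_iso_with_proj_iff:
  assumes "pair_wf_digraph G"
  shows "digraph_iso (with_proj G) (with_proj H) \<longleftrightarrow>
    (\<exists>f. inj_on f (pverts G) \<and> pverts H = f ` pverts G \<and> parcs H = map_prod f f ` parcs G)"
    (is "?L \<longleftrightarrow> ?R")
proof
  assume ?L
  then obtain h where h: "pre_digraph.digraph_isomorphism (with_proj G) h"
    and H: "with_proj H = app_iso h (with_proj G)"
    unfolding digraph_iso_def by blast
  have tl: "iso_tail h = fst" and hd: "iso_head h = snd"
    and vs: "pverts H = iso_verts h ` pverts G" and as: "parcs H = iso_arcs h ` parcs G"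
    using H by (simp_all add: with_proj_def app_iso_def)
  \<comment> \<open>The end maps of \<open>H\<close> are \<open>fst\<close> and \<open>snd\<close>,
    so compatibility with ends fixes both components of the image arc.\<close>
  have "iso_arcs h e = map_prod (iso_verts h) (iso_verts h) e" if "e \<in> parcs G" for e
    using h that tl hd by (auto simp: pre_digraph.digraph_isomorphism_def prod_eq_iff)
  then have "parcs H = map_prod (iso_verts h) (iso_verts h) ` parcs G"
    using as by (simp cong: image_cong)
  then show ?R
    using h vs by (auto simp: pre_digraph.digraph_isomorphism_def)
next
  assume ?R
  then obtain f where f: "inj_on f (pverts G)" and vs: "pverts H = f ` pverts G"
    and as: "parcs H = map_prod f f ` parcs G" by blast
  let ?h = "\<lparr>iso_verts = f, iso_arcs = map_prod f f, iso_head = snd, iso_tail = fst\<rparr>"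
  interpret pair_wf_digraph G by fact
  have "inj_on (map_prod f f) (pverts G \<times> pverts G)"
    using f by (intro map_prod_inj_on)
  then have "inj_on (map_prod f f) (parcs G)"
    by (rule inj_on_subset) (auto dest: in_arcsD1 in_arcsD2)
  then have "pre_digraph.digraph_isomorphism (with_proj G) ?h"
    using f wf_digraph_axioms by (simp add: pre_digraph.digraph_isomorphism_def)
  moreover have "with_proj H = app_iso ?h (with_proj G)"
    using vs as by (simp add: with_proj_def app_iso_def)
  ultimately show ?L
    unfolding digraph_iso_def by blast
qed

section \<open>Alternating words and palindromes\<close>

lemma successively_neq_concat:
  "successively (\<noteq>) (concat (replicate n [0, 1 :: bit]))"
  "successively (\<noteq>) (concat (replicate n [0, 1 :: bit]) @ [0])"
proof -
  \<comment> \<open>The longer word comes first, since the other is a prefix of it. Two-step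
    induction exposes the block after the first, hence the letter following its 1.\<close>
  show *: "successively (\<noteq>) (concat (replicate n [0, 1 :: bit]) @ [0])" for n
    by (induction n rule: induct_nat_012) auto
  then show "successively (\<noteq>) (concat (replicate n [0, 1 :: bit]))"
    by (metis successively_append_iff)
qed

lemma L_wrep_successively_neq:
  assumes "u \<in> L_wrep"
  shows "successively (\<noteq>) u"
proof -
  obtain n x z where u: "u = x @ concat (replicate n [0, 1]) @ z"
    and x: "x = [1] \<or> x = []" and z: "z = [0] \<or> z = []"
    using assms unfolding L_wrep_conv by blast
  have "successively (\<noteq>) (concat (replicate n [0, 1 :: bit]) @ z)"
    using z successively_neq_concat by auto
  then show ?thesis
    using u x z by (cases n) auto
qed

lemma concat_replicate_Suc: "concat (replicate (Suc n) xs) = concat (replicate n xs) @ xs"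
  by (induction n) auto

text \<open>A nonempty alternating word of even length has different end letters, whereas those of a
  palindrome agree.\<close>

lemma odd_length_L_pal_wrep:
  assumes "u \<in> L_pal \<inter> L_wrep"
  shows "odd (length u)"
proof -
  have "u \<in> L_wrep"
    using assms by simp
  then obtain n x z where u: "u = x @ concat (replicate n [0, 1]) @ z"
    and x: "x = [1] \<or> x = []" and z: "z = [0] \<or> z = []"
    unfolding L_wrep_conv by blast
  have len: "length (concat (replicate n [0, 1 :: bit])) = 2 * n"
    by (induction n) auto
  have u': "u \<noteq> []" "rev u = u"
    using assms by (simp_all add: L_pal_def)
  then have hl: "hd u = last u"
    by (metis hd_rev)
  show ?thesis
  proof (rule ccontr)
    assume "\<not> odd (length u)"
    \<comment> \<open>Even length means that the optional end letters are both present or both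
      absent.\<close>
    with x z consider "x = [1]" "z = [0]" | "x = []" "z = []"
      unfolding u by (auto simp: len)
    then show False
    proof cases
      case 1
      then show False using hl u by simp
    next
      case 2
      then obtain m where m: "n = Suc m"
        using u' u by (cases n) auto
      have "hd u = 0" using 2 m u by simp
      moreover have "last u = 1" using 2 u unfolding m concat_replicate_Suc by simp
      ultimately show False using hl by simp
    qed
  qed
qed

lemma concat_replicate_in_L_pal_wrep:
  "concat (replicate n [0, 1]) @ [0] \<in> L_pal \<inter> L_wrep"
proof -
  have "rev (concat (replicate n [0, 1 :: bit]) @ [0]) = concat (replicate n [0, 1]) @ [0]"
  proof (induction n)
    case (Suc n)
    \<comment> \<open>Regrouped this way, reversal turns the trailing 10 into a leading 01 and the
      induction hypothesis handles the rest.\<close>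
    have "concat (replicate (Suc n) [0, 1]) @ [0] = concat (replicate n [0, 1 :: bit]) @ [0] @ [1, 0]"
      by (simp only: concat_replicate_Suc append_assoc append.simps)
    then show ?case using Suc by simp
  qed simp
  then show ?thesis
    unfolding L_pal_def using L_wrep_conv by fastforce
qed

text \<open>The closing 0 forces the last block to end in 1, so it is 01 and begins with 0; this
  propagates from right to left.\<close>

lemma successively_neq_concat_blocks:
  assumes "set bs \<subseteq> {[0, 1], [1, 0 :: bit]}" and "successively (\<noteq>) (concat bs @ [0])"
  shows "bs = replicate (length bs) [0, 1]"
  using assms
proof (induction bs)
  case (Cons b bs)
  have "successively (\<noteq>) (concat bs @ [0])"
    using Cons.prems by (simp add: successively_append_iff)
  then have bs: "bs = replicate (length bs) [0, 1]"
    using Cons by simp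
  \<comment> \<open>Whatever follows \<open>b\<close> starts with 0, even when no block
    remains.\<close>
  have "concat (replicate n [0, 1 :: bit]) @ [0] = 0 # tl (concat (replicate n [0, 1]) @ [0])" for n
    by (cases n) auto
  then obtain zs where "concat bs @ [0] = 0 # zs"
    using bs by metis
  then have "b = [0, 1]"
    using Cons.prems by auto
  then show ?case using bs by simp
qed simp

section \<open>Projections and renaming of letters\<close>

lemma proj_word_simps [simp]:
  "proj_word u v [] = []"
  "proj_word u v (x # w) = (if x = u then [0] else if x = v then [1] else []) @ proj_word u v w"
  "proj_word u v (w @ w') = proj_word u v w @ proj_word u v w'"
  by (simp_all add: proj_word_def)

lemma proj_word_concat: "proj_word u v (concat ws) = concat (map (proj_word u v) ws)"
  by (induction ws) auto

lemma length_proj_word: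
  "u \<noteq> v \<Longrightarrow> length (proj_word u v w) = count_list w u + count_list w v"
  by (induction w) auto

lemma proj_word_eq_Nil: "u \<notin> set w \<Longrightarrow> v \<notin> set w \<Longrightarrow> proj_word u v w = []"
  by (induction w) auto

lemma proj_word_distinct:
  "distinct w \<Longrightarrow> u \<in> set w \<Longrightarrow> v \<notin> set w \<Longrightarrow> proj_word u v w = [0]"
  "distinct w \<Longrightarrow> u \<notin> set w \<Longrightarrow> v \<in> set w \<Longrightarrow> proj_word u v w = [1]"
  by (induction w) (auto simp: proj_word_eq_Nil)

lemma proj_word_map:
  "inj_on f (insert u (insert v (set w))) \<Longrightarrow> proj_word (f u) (f v) (map f w) = proj_word u v w"
  by (induction w) (auto simp: inj_on_def)

lemma count_list_distinct: "distinct w \<Longrightarrow> count_list w x = (if x \<in> set w then 1 else 0)"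
  by (induction w) auto

lemma word_graph_map:
  assumes "inj_on f (set w)"
  shows "pverts (word_graph L (map f w)) = f ` pverts (word_graph L w)"
    and "parcs (word_graph L (map f w)) = map_prod f f ` parcs (word_graph L w)"
proof -
  have *: "proj_word (f u) (f v) (map f w) = proj_word u v w" if "u \<in> set w" "v \<in> set w" for u v
    using assms that by (intro proj_word_map) (simp add: insert_absorb)
  show "pverts (word_graph L (map f w)) = f ` pverts (word_graph L w)"
    by (simp add: word_graph_def)
  show "parcs (word_graph L (map f w)) = map_prod f f ` parcs (word_graph L w)"
    using assms by (force simp: word_graph_def * dest: inj_onD)
qed

text \<open>Allows words over the vertex type itself: an injection of the finitely many letters into
  \<open>nat\<close> only renames the vertices.\<close>

lemma word_graph_in_graph_class:
  assumes "simple_graph G" and "word_graph L w = G"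
  shows "G \<in> graph_class L"
proof -
  interpret pair_graph G using assms(1) by (simp add: simple_graph_def)
  have verts: "set w = pverts G"
    using assms(2) by (auto simp: word_graph_def)
  then obtain f :: "'a \<Rightarrow> nat" where "inj_on f (set w)"
    using finite_imp_inj_to_nat_seg[OF finite_set, of w] by blast
  then have "digraph_iso (with_proj G) (with_proj (word_graph L (map f w)))"
    unfolding digraph_iso_with_proj_iff[OF pair_wf_digraph_axioms]
    using word_graph_map[of f w L] unfolding assms(2) verts by blast
  moreover have "w \<noteq> []"
    using verts assms(1) by (auto simp: simple_graph_def)
  ultimately show ?thesis
    using assms(1) unfolding graph_class_def by blast
qed

section \<open>From words to bipartitions\<close>

lemma graph_class_bipartite:
  assumes "G \<in> graph_class (L_pal \<inter> L_wrep)"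
  shows "bipartite G"
proof -
  obtain w :: "nat list" where G: "simple_graph G"
    and iso: "digraph_iso (with_proj G) (with_proj (word_graph (L_pal \<inter> L_wrep) w))"
    using assms unfolding graph_class_def by blast
  interpret pair_graph G using G by (simp add: simple_graph_def)
  obtain f where
    arcs: "parcs (word_graph (L_pal \<inter> L_wrep) w) = map_prod f f ` parcs G"
    using iso by (auto simp: digraph_iso_with_proj_iff[OF pair_wf_digraph_axioms])
  have parity: "even (count_list w (f u)) \<noteq> even (count_list w (f v))" if "(u, v) \<in> parcs G" for u v
  proof -
    have "(f u, f v) \<in> parcs (word_graph (L_pal \<inter> L_wrep) w)"
      using that arcs by force
    then have "f u \<noteq> f v" "odd (length (proj_word (f u) (f v) w))"
      by (auto simp: word_graph_def intro!: odd_length_L_pal_wrep)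
    then show ?thesis by (simp add: length_proj_word)
  qed
  \<comment> \<open>The parity classes of letters are pulled back along \<open>f\<close> to the
    vertices of \<open>G\<close>.\<close>
  let ?A = "{u \<in> pverts G. even (count_list w (f u))}"
  let ?B = "{u \<in> pverts G. odd (count_list w (f u))}"
  have "independent G ?A" "independent G ?B"
    using parity by (auto simp: independent_def)
  moreover have "pverts G = ?A \<union> ?B" "?A \<inter> ?B = {}"
    by auto
  ultimately show ?thesis
    unfolding bipartite_def by blast
qed

section \<open>The word of a bipartite graph\<close>

definition block :: "('a \<Rightarrow> 'a \<Rightarrow> bool) \<Rightarrow> 'a list \<Rightarrow> 'a list \<Rightarrow> 'a \<Rightarrow> 'a list" where
  "block N P Q c = filter (N c) P @ c # filter (\<lambda>a. \<not> N c a) P @ removeAll c Q"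

text \<open>The final \<open>P\<close> supplies the closing 0 of the projections, and all the
  letters of \<open>P\<close> when \<open>Q\<close> is empty.\<close>

definition bipartite_word :: "('a \<Rightarrow> 'a \<Rightarrow> bool) \<Rightarrow> 'a list \<Rightarrow> 'a list \<Rightarrow> 'a list" where
  "bipartite_word N P Q = concat (map (block N P Q) Q) @ P"

lemma set_bipartite_word: "set (bipartite_word N P Q) = set P \<union> set Q"
  by (auto simp: bipartite_word_def block_def)

context
  fixes P Q :: "'a list"
  assumes distinct: "distinct P" "distinct Q" and disjoint: "set P \<inter> set Q = {}"
begin

lemma count_list_block:
  assumes "c \<in> set Q" and "x \<in> set P \<union> set Q"
  shows "count_list (block N P Q c) x = 1"
  using assms distinct disjoint
  by (auto simp: block_def count_list_distinct distinct_removeAll)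

lemma count_list_bipartite_word:
  assumes "x \<in> set P \<union> set Q"
  shows "count_list (bipartite_word N P Q) x = length Q + (if x \<in> set P then 1 else 0)"
proof -
  \<comment> \<open>The list of block indices is generalised to \<open>R\<close>, while the
    \<open>Q\<close> inside each block stays fixed during the induction.\<close>
  have "count_list (concat (map (block N P Q) R)) x = length R" if "set R \<subseteq> set Q" for R
    using that assms by (induction R) (auto simp: count_list_block)
  then show ?thesis
    using distinct by (simp add: bipartite_word_def count_list_distinct)
qed

text \<open>For \<open>c\<close> other than \<open>b\<close>, the letter \<open>b\<close> lies in
  the tail of the block, after all of \<open>P\<close>. For \<open>c = b\<close>, the filters put
  \<open>a\<close> before or after \<open>b\<close> according to \<open>N b a\<close>.\<close>

lemma proj_word_block:
  assumes "a \<in> set P" "b \<in> set Q" "c \<in> set Q"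
  shows "proj_word a b (block N P Q c) = (if c = b \<and> \<not> N b a then [1, 0] else [0, 1])"
proof -
  have ab: "a \<notin> set Q" "b \<notin> set P" "a \<noteq> c" using assms disjoint by auto
  have "proj_word a b (filter R P) = (if R a then [0] else [])" for R
    using assms ab distinct by (auto simp: proj_word_distinct proj_word_eq_Nil)
  moreover have "proj_word a b (removeAll c Q) = (if c = b then [] else [1])"
    using assms ab distinct
    by (auto simp: proj_word_distinct proj_word_eq_Nil distinct_removeAll)
  ultimately show ?thesis
    using ab by (auto simp: block_def)
qed

lemma proj_bipartite_word_in_L_iff:
  assumes a: "a \<in> set P" and b: "b \<in> set Q"
  shows "proj_word a b (bipartite_word N P Q) \<in> L_pal \<inter> L_wrep \<longleftrightarrow> N b a"
proof -
  let ?bs = "map (\<lambda>c. if c = b \<and> \<not> N b a then [1, 0] else [0, 1 :: bit]) Q"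
  have "proj_word a b P = [0]"
    using a b distinct disjoint by (intro proj_word_distinct) auto
  moreover have "map (proj_word a b) (map (block N P Q) Q) = ?bs"
    using a b by (simp add: proj_word_block)
  ultimately have w: "proj_word a b (bipartite_word N P Q) = concat ?bs @ [0]"
    by (simp only: bipartite_word_def proj_word_simps proj_word_concat)
  show ?thesis
  proof
    assume "N b a"
    then have "?bs = replicate (length Q) [0, 1]"
      by (simp add: map_replicate_const)
    then show "proj_word a b (bipartite_word N P Q) \<in> L_pal \<inter> L_wrep"
      unfolding w by (metis concat_replicate_in_L_pal_wrep)
  next
    assume "proj_word a b (bipartite_word N P Q) \<in> L_pal \<inter> L_wrep"
    then have "successively (\<noteq>) (concat ?bs @ [0])"
      unfolding w by (intro L_wrep_successively_neq) simp
    then have "?bs = replicate (length ?bs) [0, 1]"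
      by (intro successively_neq_concat_blocks) auto
    then have "set ?bs \<subseteq> {[0, 1]}"
      by (metis set_replicate_conv_if empty_subsetI subset_refl)
    \<comment> \<open>As \<open>b\<close> is in \<open>Q\<close>, its own block is among those
      listed, and it would be 10 if \<open>N b a\<close> failed.\<close>
    then show "N b a"
      using b by (auto split: if_splits)
  qed
qed

end

lemma bipartite_in_graph_class:
  assumes "simple_graph G" and "bipartite G"
  shows "G \<in> graph_class (L_pal \<inter> L_wrep)"
proof -
  let ?L = "L_pal \<inter> L_wrep"
  interpret pair_graph G using assms(1) by (simp add: simple_graph_def)
  obtain A B where AB: "pverts G = A \<union> B" "A \<inter> B = {}" and
    ind: "independent G A" "independent G B"
    using assms(2) unfolding bipartite_def by blast
  have "finite A" "finite B"
    using AB(1) pair_finite_verts by simp_all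
  then obtain P Q where P: "set P = A" "distinct P" and Q: "set Q = B" "distinct Q"
    by (metis finite_distinct_list)
  define N where "N b a \<longleftrightarrow> (a, b) \<in> parcs G" for a b
  define w where "w = bipartite_word N P Q"
  have dj: "set P \<inter> set Q = {}" using P Q AB by simp
  have set_w: "set w = pverts G"
    using P Q AB by (simp add: w_def set_bipartite_word)
  have sym: "(u, v) \<in> parcs G \<longleftrightarrow> (v, u) \<in> parcs G" for u v
    using pair_sym_arcs by (auto simp: symmetric_def dest: symD)
  \<comment> \<open>The construction only controls projections with the \<open>P\<close> letter sent
    to 0; exchanging 0 and 1 covers the other order.\<close>
  have sym_L: "proj_word u v w \<in> ?L \<longleftrightarrow> proj_word v u w \<in> ?L" if "u \<noteq> v" for u v
    using zero_one_symmetric_L_pal_wrep map_exchange_proj_word that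
    unfolding zero_one_symmetric_def by metis
  have same: "proj_word u v w \<notin> ?L" if "u \<noteq> v" "{u, v} \<subseteq> A \<or> {u, v} \<subseteq> B" for u v
  proof -
    have "count_list w u = count_list w v"
      using that P Q AB(2) count_list_bipartite_word[OF P(2) Q(2) dj]
      by (auto simp: w_def)
    then show ?thesis
      using odd_length_L_pal_wrep[of "proj_word u v w"] that(1) by (auto simp: length_proj_word)
  qed
  have cross: "proj_word u v w \<in> ?L \<longleftrightarrow> (u, v) \<in> parcs G" if "u \<in> A" "v \<in> B" for u v
    using proj_bipartite_word_in_L_iff[OF P(2) Q(2) dj, of u v N] that P Q
    by (simp add: w_def N_def)
  have "(u, v) \<in> parcs G \<longleftrightarrow> u \<noteq> v \<and> proj_word u v w \<in> ?L"
    if uv: "u \<in> pverts G" "v \<in> pverts G" for u v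
  proof -
    consider "{u, v} \<subseteq> A \<or> {u, v} \<subseteq> B" | "u \<in> A" "v \<in> B" | "u \<in> B" "v \<in> A"
      using uv AB by auto
    then show ?thesis
    proof cases
      case 1
      then show ?thesis
        using same[of u v] ind by (auto simp: independent_def)
    next
      case 2
      then show ?thesis using cross AB by auto
    next
      case 3
      then show ?thesis using cross[of v u] sym_L[of u v] sym[of u v] AB by auto
    qed
  qed
  then have "parcs (word_graph ?L w) = parcs G"
    using set_w by (auto simp: word_graph_def dest: in_arcsD1 in_arcsD2)
  moreover have "pverts (word_graph ?L w) = pverts G"
    using set_w by (simp add: word_graph_def)
  ultimately have "word_graph ?L w = G"
    by simp
  then show ?thesis
    by (rule word_graph_in_graph_class[OF assms(1)])
qed

theorem mainTheorem8:
  shows "(graph_class (L_pal \<inter> L_wrep) :: 'a pair_pre_digraph set) = {G. simple_graph G \<and> bipartite G}"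
  using graph_class_bipartite bipartite_in_graph_class by (auto simp: graph_class_def)

end
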